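(* Let $M$ (multiplicand) and $n$ (multiplier) be nonnegative integers, and consider a yupana with $m$ rows, where $M\le 10^m-1$ and $m$ is large enough that all squares used below exist. Starting from the empty yupana, load $M$ with positive tokens; then apply the abbreviated replication of $n$ times to each of the tokens so loaded; then execute any finite sequence of table movements, in any order, ending in a state that is simple. Then the number shown by this final simple state equals $M\times n$.
   Context: **Board and states.** A yupana with $m$ rows is the board whose set of squares is $C=\{5,3,2,1\}\times\{0,1,\dots,m-1\}$; the square $(b,r)$ has weight $b$ and lies in row $r$. There are two colors of tokens, positive and negative. A state assigns to each square $(b,r)$ a number $N^+_{b,r}\in\mathbb{Z}_{\ge 0}$ of positive tokens and a number $N^-_{b,r}\in\mathbb{Z}_{\ge 0}$ of negative tokens. The effective value of a square is $E_{b,r}=(N^+_{b,r}-N^-_{b,r})\,b\,10^r$, and the value of the yupana is $\sum_{(b,r)\in C}E_{b,r}$. **Representation of digits.** A decimal digit is represented in a row by placing one token on each of the following squares of that row (listed by weight) and none on the others: $0$: none; $1$: $\{1\}$; $2$: $\{2\}$; $3$: $\{3\}$; $4$: $\{3,1\}$; $5$: $\{5\}$; $6$: $\{5,1\}$; $7$: $\{5,2\}$; $8$: $\{5,3\}$; $9$: $\{5,3,1\}$. **Loading.** Loading a number $a$ with $0\le a\le 10^m-1$ and decimal digits $d_{m-1}\cdots d_1d_0$, with tokens of a given color, means adding to the current state, for each $r$, tokens of that color representing the digit $d_r$ in row $r$. **Abbreviated replication of $n$ times a token.** Let $n$ have decimal digits $d_kd_{k-1}\cdots d_1d_0$. For a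 token on square $(b,r)$: for each $i=k,k-1,\dots,0$ place $d_i$ tokens of the same color on square $(b,r+i)$; then remove the original token from $(b,r)$. (In multiplication, only the originally loaded multiplicand tokens are replicated, not the newly placed ones.) **Simple state.** A state is simple if all its tokens have a single color and each row $r$ represents some digit $d_r\in\{0,\dots,9\}$, meaning that row $r$ has exactly one token on each square whose weight belongs to the set $S(d_r)$ and no token on its other squares, where $S(0)=\emptyset$, $S(1)=\{1\}$, $S(2)=\{2\}$, $S(3)=\{3\}$, $S(4)=\{3,1\}$, $S(5)=\{5\}$, $S(6)=\{5,1\}$, $S(7)=\{5,2\}$, $S(8)=\{5,3\}$, $S(9)=\{5,3,1\}$. The number shown by it is $\sum_r d_r10^r$ if the tokens are positive (or there are none), and $-\sum_r d_r10^r$ if they are negative. **Table movements.** Each movement below is available for every integer $k\ge1$ and row $r$ for which the tokens to be removed are present and all squares mentioned exist. Except for Chinkay, all tokens removed and placed in one movement have the same color (either one). Write $c\,[b]_r$ for $c$ tokens on square $(b,r)$; $X\to Y$ means remove $X$ and place $Y$. - Reducing: $2k[2]_r\to k[1]_r+k[3]_r$ (Iskay); $2k[3]_r\to k[1]_r+k[5]_r$ (Kimsa); $2k[5]_r\to k[1]_{r+1}$ (Pisqa); $2k[1]_r\to k[2]_r$, $3k[1]_r\to k[3]_r$, $5k[1]_r\to k[5]_r$ (Kikin); $k[1]_r+k[2]_r\to k[3]_r$, $k[2]_r+k[3]_r\to k[5]_r$ (Pichana). - Expansion: $k[5]_r\to k[3]_r+k[2]_r$; $k[3]_r\to k[2]_r+k[1]_r$;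 $k[2]_r\to 2k[1]_r$; $k[1]_{r+1}\to 2k[5]_r$; $k[1]_{r+1}\to k[5]_r+k[3]_r+k[2]_r$; $k[1]_{r+1}\to 2k[3]_r+2k[2]_r$; $k[1]_{r+1}\to k[3]_r+2k[2]_r+3k[1]_r$. - Composite: for $b\in\{5,3,2,1\}$ and $n\ge1$, $10^n[b]_r\to 1[b]_{r+n}$ (Chunka, etc.); $2k[2]_r+2k[3]_r\to k[1]_{r+1}$ (Sonqo); $k[5]_r+k[3]_r+k[2]_r\to k[1]_{r+1}$ (Hatun Pichana); $2k[3]_r+k[2]_r+2k[1]_r\to k[1]_{r+1}$ (Paña Chaska); $k[3]_r+2k[2]_r+3k[1]_r\to k[1]_{r+1}$ (Huq-Iskay-Kimsa); $3k[3]_r+k[1]_r\to k[1]_{r+1}$ (K'usillu). - Chinkay: remove $k$ positive and $k$ negative tokens from one square. *)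

theory Defs
  imports "HOL-Library.Multiset"
begin

datatype color = Positive | Negative

text \<open>A square is a pair (weight, row) and a token is a color together with the square it lies on.\<close>

type_synonym square = "nat \<times> nat"
type_synonym token = "color \<times> square"

text \<open>A state is encoded as the multiset of tokens on the board: the numbers of positive and of
  negative tokens on a square \<open>q\<close> are \<open>count s (Positive, q)\<close> and \<open>count s (Negative, q)\<close>.\<close>

type_synonym state = "token multiset"

definition weights :: "nat set" where
  "weights = {5, 3, 2, 1}"

definition board :: "nat \<Rightarrow> square set" where
  "board m = weights \<times> {..<m}"

definition tokens_on :: "state \<Rightarrow> square \<Rightarrow> nat" where
  "tokens_on s q = count s (Positive, q) + count s (Negative, q)"

definition digit :: "nat \<Rightarrow> nat \<Rightarrow> nat" where
  "digit a i = a div 10 ^ i mod 10"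

text \<open>Position of the leading decimal digit; the number 0 has the single digit 0.\<close>

definition top_position :: "nat \<Rightarrow> nat" where
  "top_position a = (LEAST k. a < 10 ^ Suc k)"

text \<open>Only used for digits \<open>d \<le> 9\<close>.\<close>

definition digit_weights :: "nat \<Rightarrow> nat set" where
  "digit_weights d =
    [{}, {1}, {2}, {3}, {3, 1}, {5}, {5, 1}, {5, 2}, {5, 3}, {5, 3, 1}] ! d"

definition load :: "nat \<Rightarrow> color \<Rightarrow> nat \<Rightarrow> state \<Rightarrow> state" where
  "load m c a s = s + (\<Sum>r<m. image_mset (\<lambda>b. (c, b, r)) (mset_set (digit_weights (digit a r))))"

text \<open>Truncation of the multiset difference is harmless here: the replicated token is meant to
  be present in \<open>s\<close>.\<close>

fun abbreviated_replication :: "nat \<Rightarrow> token \<Rightarrow> state \<Rightarrow> state" where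
  "abbreviated_replication n (c, b, r) s =
    s + (\<Sum>i\<le>top_position n. replicate_mset (digit n i) (c, b, r + i)) - {#(c, b, r)#}"

definition represents_digit :: "state \<Rightarrow> nat \<Rightarrow> nat \<Rightarrow> bool" where
  "represents_digit s r d \<longleftrightarrow>
    d \<le> 9 \<and> (\<forall>b\<in>weights. tokens_on s (b, r) = (if b \<in> digit_weights d then 1 else 0))"

definition simple_state :: "nat \<Rightarrow> state \<Rightarrow> bool" where
  "simple_state m s \<longleftrightarrow>
    (\<exists>c. \<forall>t\<in>#s. fst t = c) \<and> (\<forall>r<m. \<exists>d. represents_digit s r d)"

text \<open>Meaningful for simple states only, where the digit of each row is uniquely determined and
  the presence of one negative token means that all tokens are negative.\<close>

definition number_shown :: "nat \<Rightarrow> state \<Rightarrow> int" where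
  "number_shown m s =
    (if \<exists>t\<in>#s. fst t = Negative then - 1 else 1) *
    (\<Sum>r<m. int (THE d. represents_digit s r d) * 10 ^ r)"

abbreviation pile :: "nat \<Rightarrow> nat \<Rightarrow> nat \<Rightarrow> square multiset" where
  "pile c b r \<equiv> replicate_mset c (b, r)"

text \<open>The monochromatic movements, as pairs of the pile of tokens removed and the pile of tokens
  placed. Color, presence of the tokens and existence of the squares are dealt with in
  \<open>movement\<close> below.\<close>

inductive table_rule :: "square multiset \<Rightarrow> square multiset \<Rightarrow> bool" where
  iskay: "k \<ge> 1 \<Longrightarrow> table_rule (pile (2*k) 2 r) (pile k 1 r + pile k 3 r)"
| kimsa: "k \<ge> 1 \<Longrightarrow> table_rule (pile (2*k) 3 r) (pile k 1 r + pile k 5 r)"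
| pisqa: "k \<ge> 1 \<Longrightarrow> table_rule (pile (2*k) 5 r) (pile k 1 (r + 1))"
| kikin2: "k \<ge> 1 \<Longrightarrow> table_rule (pile (2*k) 1 r) (pile k 2 r)"
| kikin3: "k \<ge> 1 \<Longrightarrow> table_rule (pile (3*k) 1 r) (pile k 3 r)"
| kikin5: "k \<ge> 1 \<Longrightarrow> table_rule (pile (5*k) 1 r) (pile k 5 r)"
| pichana3: "k \<ge> 1 \<Longrightarrow> table_rule (pile k 1 r + pile k 2 r) (pile k 3 r)"
| pichana5: "k \<ge> 1 \<Longrightarrow> table_rule (pile k 2 r + pile k 3 r) (pile k 5 r)"
| expand5: "k \<ge> 1 \<Longrightarrow> table_rule (pile k 5 r) (pile k 3 r + pile k 2 r)"
| expand3: "k \<ge> 1 \<Longrightarrow> table_rule (pile k 3 r) (pile k 2 r + pile k 1 r)"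
| expand2: "k \<ge> 1 \<Longrightarrow> table_rule (pile k 2 r) (pile (2*k) 1 r)"
| expand10_55: "k \<ge> 1 \<Longrightarrow> table_rule (pile k 1 (r + 1)) (pile (2*k) 5 r)"
| expand10_532: "k \<ge> 1 \<Longrightarrow>
    table_rule (pile k 1 (r + 1)) (pile k 5 r + pile k 3 r + pile k 2 r)"
| expand10_3322: "k \<ge> 1 \<Longrightarrow>
    table_rule (pile k 1 (r + 1)) (pile (2*k) 3 r + pile (2*k) 2 r)"
| expand10_322111: "k \<ge> 1 \<Longrightarrow>
    table_rule (pile k 1 (r + 1)) (pile k 3 r + pile (2*k) 2 r + pile (3*k) 1 r)"
| chunka: "\<lbrakk>b \<in> weights; n \<ge> 1\<rbrakk> \<Longrightarrow> table_rule (pile (10 ^ n) b r) (pile 1 b (r + n))"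
| sonqo: "k \<ge> 1 \<Longrightarrow> table_rule (pile (2*k) 2 r + pile (2*k) 3 r) (pile k 1 (r + 1))"
| hatun_pichana: "k \<ge> 1 \<Longrightarrow>
    table_rule (pile k 5 r + pile k 3 r + pile k 2 r) (pile k 1 (r + 1))"
| pana_chaska: "k \<ge> 1 \<Longrightarrow>
    table_rule (pile (2*k) 3 r + pile k 2 r + pile (2*k) 1 r) (pile k 1 (r + 1))"
| huq_iskay_kimsa: "k \<ge> 1 \<Longrightarrow>
    table_rule (pile k 3 r + pile (2*k) 2 r + pile (3*k) 1 r) (pile k 1 (r + 1))"
| kusillu: "k \<ge> 1 \<Longrightarrow> table_rule (pile (3*k) 3 r + pile k 1 r) (pile k 1 (r + 1))"

inductive movement :: "nat \<Rightarrow> state \<Rightarrow> state \<Rightarrow> bool" for m where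
  table: "\<lbrakk>table_rule X Y; set_mset X \<subseteq> board m; set_mset Y \<subseteq> board m;
      image_mset (Pair c) X \<subseteq># s\<rbrakk>
    \<Longrightarrow> movement m s (s - image_mset (Pair c) X + image_mset (Pair c) Y)"
| chinkay: "\<lbrakk>k \<ge> 1; q \<in> board m; k \<le> count s (Positive, q); k \<le> count s (Negative, q)\<rbrakk>
    \<Longrightarrow> movement m s (s - replicate_mset k (Positive, q) - replicate_mset k (Negative, q))"

end

theory Submission
  imports Defs
begin

text \<open>Give a token on square \<open>(b, r)\<close> the value \<open>b * 10 ^ r\<close>, signed by its color, and a state the
  sum of the values of its tokens. Loading \<open>M\<close> produces a state of value \<open>M\<close>, replication multiplies
  the value of each loaded token by \<open>n\<close>, every movement preserves the value, and a simple state shows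
  its value. The last step needs that no token ever leaves the board.\<close>

fun square_value :: "square \<Rightarrow> int" where
  "square_value (b, r) = int b * 10 ^ r"

fun color_sign :: "color \<Rightarrow> int" where
  "color_sign Positive = 1"
| "color_sign Negative = - 1"

fun token_value :: "token \<Rightarrow> int" where
  "token_value (c, q) = color_sign c * square_value q"

definition state_value :: "state \<Rightarrow> int" where
  "state_value s = (\<Sum>t\<in>#s. token_value t)"

lemma state_value_simps [simp]:
  "state_value {#} = 0"
  "state_value (add_mset t s) = token_value t + state_value s"
  "state_value (s + s') = state_value s + state_value s'"
  "state_value (replicate_mset k t) = int k * token_value t"
  by (simp_all add: state_value_def)

text \<open>The inclusion rules out truncation in the multiset difference, so additivity can be read
  backwards.\<close>

lemma state_value_diff: "s' \<subseteq># s \<Longrightarrow> state_value (s - s') = state_value s - state_value s'"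
  by (metis add_diff_cancel_right' state_value_simps(3) subset_mset.diff_add)

lemma state_value_sum: "state_value (\<Sum>i\<in>A. f i) = (\<Sum>i\<in>A. state_value (f i))"
  by (induction A rule: infinite_finite_induct) simp_all

text \<open>The rules in \<open>table_rule\<close> carry no color. Factoring out the sign reduces
  their effect on the value to a comparison of uncolored squares.\<close>

lemma state_value_monochromatic:
  "state_value (image_mset (Pair c) X) = color_sign c * (\<Sum>q\<in>#X. square_value q)"
  by (induction X) (simp_all add: algebra_simps)

lemma sum_digits: "(\<Sum>i<k. digit a i * 10 ^ i) = a mod 10 ^ k"
proof (induction k)
  case (Suc k)
  have "a mod 10 ^ Suc k = 10 ^ k * digit a k + a mod 10 ^ k"
    by (simp only: power_Suc2 mod_mult2_eq digit_def)
  then show ?case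
    using Suc by simp
qed simp

lemma sum_digits_top_position: "(\<Sum>i\<le>top_position a. digit a i * 10 ^ i) = a"
proof -
  \<comment> \<open>The witness \<open>a\<close> shows that the \<open>LEAST\<close> in
    \<open>top_position\<close> ranges over a nonempty set.\<close>
  have "a < 10 ^ Suc a"
    using power_gt_expt[of 10 "Suc a"] by simp
  then have "a < 10 ^ Suc (top_position a)"
    unfolding top_position_def by (rule LeastI)
  then show ?thesis
    using sum_digits[where a = a and k = "Suc (top_position a)"]
    by (simp only: lessThan_Suc_atMost mod_less)
qed

lemma less_10_cases:
  "(d :: nat) \<le> 9 \<Longrightarrow> d \<in> {0, 1, 2, 3, 4, 5, 6, 7, 8, 9}"
  by auto

lemma digit_weights_subset: "d \<le> 9 \<Longrightarrow> digit_weights d \<subseteq> weights"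
  by (drule less_10_cases) (auto simp: digit_weights_def weights_def)

text \<open>A check of the ten patterns, used in both directions: a loaded row is worth its digit,
  and the digit of a row of a simple state can be read off its tokens.\<close>

lemma sum_digit_weights: "d \<le> 9 \<Longrightarrow> \<Sum>(digit_weights d) = d"
  by (drule less_10_cases) (auto simp: digit_weights_def)

lemma finite_weights [simp]: "finite weights"
  by (simp add: weights_def)

lemma digit_le_9: "digit a i \<le> 9"
  by (simp add: digit_def flip: less_Suc_eq_le)

lemma state_value_row:
  "finite B \<Longrightarrow>
    state_value (image_mset (\<lambda>b. (Positive, b, r)) (mset_set B)) = int (\<Sum>B) * 10 ^ r"
  by (induction B rule: finite_induct) (simp_all add: algebra_simps)

lemma state_value_load:
  assumes "a < 10 ^ m"
  shows "state_value (load m Positive a {#}) = int a"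
proof -
  have "state_value (load m Positive a {#}) = (\<Sum>r<m. int (digit a r) * 10 ^ r)"
    \<comment> \<open>Finiteness matters because \<open>mset_set\<close> of an infinite set is
      empty.\<close>
    using finite_subset[OF digit_weights_subset[OF digit_le_9] finite_weights]
    by (simp add: load_def state_value_sum state_value_row sum_digit_weights digit_le_9)
  also have "\<dots> = int (\<Sum>r<m. digit a r * 10 ^ r)"
    by simp
  finally show ?thesis
    using assms by (simp only: sum_digits mod_less)
qed

lemma set_mset_sum: "finite A \<Longrightarrow> set_mset (\<Sum>i\<in>A. f i) = (\<Union>i\<in>A. set_mset (f i))"
  by (induction A rule: finite_induct) simp_all

text \<open>A copy \<open>i\<close> rows up is worth \<open>10 ^ i\<close> times the original, so
  the digits of \<open>n\<close> as multiplicities add up to the factor \<open>n\<close>.\<close>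

lemma state_value_copies:
  "state_value (\<Sum>i\<le>top_position n. replicate_mset (digit n i) (c, b, r + i))
    = int n * token_value (c, b, r)"
proof -
  have "state_value (\<Sum>i\<le>top_position n. replicate_mset (digit n i) (c, b, r + i))
      = int (\<Sum>i\<le>top_position n. digit n i * 10 ^ i) * token_value (c, b, r)"
    by (simp add: state_value_sum sum_distrib_left power_add mult_ac)
  then show ?thesis
    by (simp only: sum_digits_top_position)
qed

text \<open>Each step gains \<open>n\<close> times the value of its token and loses the original.
  The list \<open>ts\<close> fixes beforehand which tokens are replicated, so new copies are not
  replicated in turn.\<close>

lemma state_value_replicate_all:
  assumes "mset ts \<subseteq># s"
  shows "state_value (fold (abbreviated_replication n) ts s)
    = state_value s + (int n - 1) * state_value (mset ts)"
  using assms
proof (induction ts arbitrary: s)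
  case (Cons t ts)
  obtain c b r where t: "t = (c, b, r)"
    by (cases t) auto
  define new where "new = (\<Sum>i\<le>top_position n. replicate_mset (digit n i) (c, b, r + i))"
  \<comment> \<open>As \<open>t\<close> lies in \<open>s\<close>, it may be removed before the
    copies are added. In this form the tokens still to be replicated visibly survive.\<close>
  have step: "abbreviated_replication n t s = s - {#t#} + new"
    using Cons.prems by (simp add: t new_def insert_subset_eq_iff)
  have "mset ts \<subseteq># s - {#t#}"
    using Cons.prems by (simp add: insert_subset_eq_iff)
  then have "mset ts \<subseteq># abbreviated_replication n t s"
    unfolding step by (rule subset_mset.order_trans) simp
  moreover have "state_value (abbreviated_replication n t s)
      = state_value s + (int n - 1) * token_value t"
    using Cons.prems state_value_copies[of n c b r]
    by (simp add: step state_value_diff insert_subset_eq_iff new_def t algebra_simps)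
  ultimately show ?case
    by (simp add: Cons.IH algebra_simps)
qed simp

text \<open>The type \<open>state\<close> admits tokens on arbitrary pairs, whereas
  \<open>number_shown\<close> inspects only squares of the board.\<close>

definition on_board :: "nat \<Rightarrow> state \<Rightarrow> bool" where
  "on_board m s \<longleftrightarrow> snd ` set_mset s \<subseteq> board m"

lemma on_board_load: "on_board m (load m c a {#})"
proof -
  have "digit_weights (digit a r) \<subseteq> weights" for r
    by (rule digit_weights_subset[OF digit_le_9])
  then show ?thesis
    using finite_subset[OF digit_weights_subset[OF digit_le_9] finite_weights]
    by (fastforce simp: on_board_def load_def board_def set_mset_sum)
qed

lemma on_board_replicate_all:
  assumes "on_board m s" "\<forall>(c, b, r)\<in>set ts. \<forall>i\<le>top_position n. (b, r + i) \<in> board m"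
  shows "on_board m (fold (abbreviated_replication n) ts s)"
  using assms
proof (induction ts arbitrary: s)
  case (Cons t ts)
  have "on_board m (abbreviated_replication n t s)"
    using Cons.prems
    by (cases t) (fastforce simp: on_board_def set_mset_sum dest!: in_diffD split: if_splits)
  then show ?case
    using Cons by simp
qed simp

text \<open>Every rule is an identity between weights, such as 2 + 2 = 1 + 3 or 3 + 3 + 3 + 1 = 10,
  scaled by \<open>k\<close> and \<open>10 ^ r\<close>; \<open>power_add\<close> covers the jump by
  \<open>n\<close> rows in \<open>chunka\<close>.\<close>

lemma table_rule_square_value:
  "table_rule X Y \<Longrightarrow> (\<Sum>q\<in>#X. square_value q) = (\<Sum>q\<in>#Y. square_value q)"
  by (induction rule: table_rule.induct) (simp_all add: power_add)

lemma movement_state_value: "movement m s s' \<Longrightarrow> state_value s' = state_value s"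
proof (induction rule: movement.induct)
  case (table X Y c s)
  then show ?case
    by (simp only: state_value_simps state_value_diff state_value_monochromatic
        table_rule_square_value diff_add_cancel)
next
  case (chinkay k q s)
  have "replicate_mset k (Positive, q) \<subseteq># s"
    using chinkay by (simp add: count_le_replicate_mset_subset_eq)
  \<comment> \<open>Removing positive tokens leaves the negative count unchanged. The two
    differences stay separate below, so that each inclusion justifies one use of
    \<open>state_value_diff\<close>.\<close>
  moreover have "replicate_mset k (Negative, q) \<subseteq># s - replicate_mset k (Positive, q)"
    using chinkay by (simp flip: count_le_replicate_mset_subset_eq)
  ultimately show ?case
    by (simp add: state_value_diff del: diff_diff_add_mset)
qed

lemma movement_on_board: "movement m s s' \<Longrightarrow> on_board m s \<Longrightarrow> on_board m s'"
  by (induction rule: movement.induct) (fastforce simp: on_board_def dest!: in_diffD)+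

text \<open>An explicit formula for the digit makes it unique, which gives the \<open>THE\<close> in
  \<open>number_shown\<close> its meaning.\<close>

lemma represents_digit_eq:
  assumes "represents_digit s r d"
  shows "d = (\<Sum>b\<in>weights. b * tokens_on s (b, r))"
proof -
  have d: "d \<le> 9"
    using assms by (simp add: represents_digit_def)
  have "(\<Sum>b\<in>weights. b * tokens_on s (b, r))
      = (\<Sum>b\<in>weights. if b \<in> digit_weights d then b else 0)"
    using assms by (intro sum.cong) (auto simp: represents_digit_def)
  also have "\<dots> = \<Sum>(digit_weights d)"
    using digit_weights_subset[OF d] by (simp add: Int_absorb1 flip: sum.inter_restrict)
  finally show ?thesis
    using d by (simp add: sum_digit_weights)
qed

lemma state_value_on_board:
  assumes "on_board m s"
  shows "state_value s
    = (\<Sum>q\<in>board m. (int (count s (Positive, q)) - int (count s (Negative, q))) * square_value q)"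
  using assms
proof (induction s)
  case (add t s)
  obtain c q where t: "t = (c, q)"
    by (cases t)
  have q: "q \<in> board m" "on_board m s"
    using add.prems by (auto simp: t on_board_def)
  \<comment> \<open>The new token alters only the summand of its own square \<open>q\<close>, which
    occurs in the sum because \<open>q\<close> is on the board.\<close>
  have "(\<Sum>p\<in>board m. (int (count (add_mset t s) (Positive, p))
        - int (count (add_mset t s) (Negative, p))) * square_value p)
      = (\<Sum>p\<in>board m. (int (count s (Positive, p)) - int (count s (Negative, p))) * square_value p
        + (if p = q then token_value t else 0))"
    by (intro sum.cong) (cases c; auto simp: t algebra_simps)+
  then show ?case
    using q add.IH by (simp add: sum.distrib board_def)
qed simp

lemma number_shown_eq_state_value:
  assumes "simple_state m s" "on_board m s"
  shows "number_shown m s = state_value s"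
proof -
  let ?\<sigma> = "if \<exists>t\<in>#s. fst t = Negative then - 1 else 1 :: int"
  have THE_eq: "(THE d. represents_digit s r d) = (\<Sum>b\<in>weights. b * tokens_on s (b, r))"
    if "r < m" for r
    using assms(1) that represents_digit_eq unfolding simple_state_def
    by (metis the_equality)
  obtain c where c: "fst t = c" if "t \<in># s" for t
    using assms(1) unfolding simple_state_def by blast
  have absent: "count s (c', q) = 0" if "c' \<noteq> c" for c' q
    using c that by (metis fst_conv not_in_iff)
  \<comment> \<open>In a single-colored state one of the two counts vanishes. The empty state falls
    under the second case, with sign 1.\<close>
  have sign: "?\<sigma> * int (tokens_on s q) = int (count s (Positive, q)) - int (count s (Negative, q))"
    for q
  proof (cases "\<exists>t\<in>#s. fst t = Negative")
    case True
    then have "c = Negative"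
      using c by auto
    with True show ?thesis
      by (simp add: tokens_on_def absent)
  next
    case False
    then have "count s (Negative, q) = 0"
      by (metis fst_conv not_in_iff)
    with False show ?thesis
      by (simp add: tokens_on_def)
  qed
  have "number_shown m s
      = ?\<sigma> * (\<Sum>r<m. \<Sum>b\<in>weights. int (tokens_on s (b, r)) * square_value (b, r))"
    by (simp add: number_shown_def THE_eq sum_distrib_left sum_distrib_right mult_ac)
  also have "\<dots> = ?\<sigma> * (\<Sum>q\<in>board m. int (tokens_on s q) * square_value q)"
    unfolding board_def
    \<comment> \<open>The digits are summed row by row, but \<open>board m\<close> has the weight as
      first coordinate.\<close>
    by (subst sum.swap) (auto simp: sum.cartesian_product intro!: sum.cong)
  also have "\<dots> = (\<Sum>q\<in>board m. ?\<sigma> * int (tokens_on s q) * square_value q)"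
    by (simp only: sum_distrib_left mult.assoc)
  also have "\<dots> = state_value s"
    by (simp only: sign state_value_on_board[OF assms(2)])
  finally show ?thesis .
qed

theorem theorem8:
  fixes M n m :: nat and loaded replicated final :: state and ts :: "token list"
  assumes M_le: "M \<le> 10 ^ m - 1"
    and loaded: "loaded = load m Positive M {#}"
    and room: "\<forall>(c, b, r)\<in>#loaded. \<forall>i\<le>top_position n. (b, r + i) \<in> board m"
    and order: "mset ts = loaded"
    and replicated: "replicated = fold (abbreviated_replication n) ts loaded"
    and moves: "(movement m)\<^sup>*\<^sup>* replicated final"
    and simple: "simple_state m final"
  shows "number_shown m final = int (M * n)"
proof -
  have "M < 10 ^ m"
    using M_le by (simp add: Suc_le_eq le_diff_conv2)
  then have "state_value loaded = int M"
    by (simp add: loaded state_value_load)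
  \<comment> \<open>Since \<open>ts\<close> lists all loaded tokens, the value becomes M + (n - 1) *
    M.\<close>
  then have "state_value replicated = int (M * n)"
    using state_value_replicate_all[of ts loaded n] by (simp add: replicated order algebra_simps)
  moreover have "set ts = set_mset loaded"
    by (simp flip: order)
  then have "on_board m replicated"
    unfolding replicated using room
    by (intro on_board_replicate_all) (simp_all add: loaded on_board_load)
  with moves have "state_value final = state_value replicated \<and> on_board m final"
    by (induction rule: rtranclp_induct) (simp_all add: movement_state_value movement_on_board)
  ultimately show ?thesis
    using simple by (simp add: number_shown_eq_state_value)
qed

end
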